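(* Let $\Gamma=(V,E)$ be an antipodal association scheme graph with diameter $d\ge1$, with a qubit at each vertex, let $o\in V$ and let $o'$ be its antipode. Then there exist real coupling constants $J_0,\dots,J_d$ and a time $t^*>0$ such that the Heisenberg Hamiltonian $$H=\frac{1}{2t^*}\sum_{i=0}^{d}J_i\sum_{k,l:\,\partial(k,l)=i}\vec\sigma_k\cdot\vec\sigma_l$$ on $(\mathbb{C}^2)^{\otimes V}$ evolves the one-particle state $|o\rangle$ at time $t^*$ into a state $e^{-iHt^*}|o\rangle$ in which the qubits at $o$ and $o'$ are maximally entangled, i.e. their entanglement is $C=1$.
   Context: Graphs are finite, simple and connected; $\partial(x,y)$ is the graph distance. A graph is an association scheme graph if for all $i,j$ the number $|\{z\in V:\partial(x,z)=i,\ \partial(z,y)=j\}|$ depends on the vertices $x,y$ only through $\partial(x,y)$. Its diameter is denoted $d$. It is antipodal if for each vertex $o$ there is exactly one vertex $o'$ (the antipode of $o$) with $\partial(o,o')=d$. The Hilbert space is $(\mathbb{C}^2)^{\otimes V}$; $|k\rangle$ denotes the one-particle state in which the qubit at $k\in V$ is up and all others are down; $\vec\sigma_k=(\sigma_k^x,\sigma_k^y,\sigma_k^z)$ are the Pauli matrices acting on the qubit at $k$, and $\vec\sigma_k\cdot\vec\sigma_l=\sigma_k^x\sigma_l^x+\sigma_k^y\sigma_l^y+\sigma_k^z\sigma_l^z$. The inner sum runs over unordered pairs $\{k,l\}$ at distance $i$ (for $i=0$, $k=l$, giving a multiple of the identity). The span of the states $|k\rangle$ is invariant under $H$. In a one-particle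 state $\sum_k\upsilon_k|k\rangle$ the entanglement (concurrence) between the qubits at distinct vertices $m,n$ is $C_{mn}=2|\upsilon_m\upsilon_n|$. *)

theory Defs
  imports "HOL-Analysis.Analysis" "HOL-Library.Uprod"
begin

text \<open>A graph is given by its adjacency relation on a finite vertex type, so V = \<^term>\<open>UNIV\<close>.\<close>

definition connected_simple_graph :: "('v::finite \<Rightarrow> 'v \<Rightarrow> bool) \<Rightarrow> bool" where
  "connected_simple_graph E \<longleftrightarrow> symp E \<and> irreflp E \<and> (\<forall>x y. E\<^sup>*\<^sup>* x y)"

text \<open>The length of a shortest walk; meaningful because the graphs considered are connected.\<close>

definition gdist :: "('v::finite \<Rightarrow> 'v \<Rightarrow> bool) \<Rightarrow> 'v \<Rightarrow> 'v \<Rightarrow> nat" where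
  "gdist E x y = (LEAST n. (E ^^ n) x y)"

definition graph_diameter :: "('v::finite \<Rightarrow> 'v \<Rightarrow> bool) \<Rightarrow> nat" where
  "graph_diameter E = Max {gdist E x y | x y. True}"

definition association_scheme_graph :: "('v::finite \<Rightarrow> 'v \<Rightarrow> bool) \<Rightarrow> bool" where
  "association_scheme_graph E \<longleftrightarrow> connected_simple_graph E \<and>
     (\<forall>i j x y x' y'. gdist E x y = gdist E x' y' \<longrightarrow>
        card {z. gdist E x z = i \<and> gdist E z y = j} =
        card {z. gdist E x' z = i \<and> gdist E z y' = j})"

definition antipodal :: "('v::finite \<Rightarrow> 'v \<Rightarrow> bool) \<Rightarrow> bool" where
  "antipodal E \<longleftrightarrow> (\<forall>x. \<exists>!x'. gdist E x x' = graph_diameter E)"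

definition antipode :: "('v::finite \<Rightarrow> 'v \<Rightarrow> bool) \<Rightarrow> 'v \<Rightarrow> 'v" where
  "antipode E x = (THE x'. gdist E x x' = graph_diameter E)"

text \<open>The tensor power of the qubit space over the vertices is coordinatised by its product
  basis: the basis vectors are indexed by the configurations \<^typ>\<open>'v \<Rightarrow> 2\<close>, where the
  index 1 means up and the index 2 means down.\<close>

type_synonym 'v qstate = "complex ^ ('v \<Rightarrow> 2)"
type_synonym 'v qop = "complex ^ ('v \<Rightarrow> 2) ^ ('v \<Rightarrow> 2)"

definition tensor_op :: "('v::finite \<Rightarrow> complex ^ 2 ^ 2) \<Rightarrow> 'v qop" where
  "tensor_op A = (\<chi> s t. \<Prod>m\<in>UNIV. A m $ s m $ t m)"

definition site_op :: "'v::finite \<Rightarrow> complex ^ 2 ^ 2 \<Rightarrow> 'v qop" where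
  "site_op k A = tensor_op (\<lambda>m. if m = k then A else mat 1)"

definition pauli_x :: "complex ^ 2 ^ 2" where
  "pauli_x = vector [vector [0, 1], vector [1, 0]]"

definition pauli_y :: "complex ^ 2 ^ 2" where
  "pauli_y = vector [vector [0, - \<i>], vector [\<i>, 0]]"

definition pauli_z :: "complex ^ 2 ^ 2" where
  "pauli_z = vector [vector [1, 0], vector [0, - 1]]"

definition pauli_dot :: "'v::finite \<Rightarrow> 'v \<Rightarrow> 'v qop" where
  "pauli_dot k l = site_op k pauli_x ** site_op l pauli_x
                 + site_op k pauli_y ** site_op l pauli_y
                 + site_op k pauli_z ** site_op l pauli_z"

lemma tensor_op_mult: "tensor_op A ** tensor_op B = tensor_op (\<lambda>m. A m ** B m)"
proof -
  have "(\<Sum>u\<in>UNIV. (\<Prod>m\<in>UNIV. A m $ s m $ u m) * (\<Prod>m\<in>UNIV. B m $ u m $ t m)) =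
        (\<Prod>m\<in>UNIV. \<Sum>c\<in>UNIV. A m $ s m $ c * B m $ c $ t m)" for s t :: "'a \<Rightarrow> 2"
    by (subst prod_sum_PiE) (simp_all add: prod.distrib PiE_UNIV_domain)
  then show ?thesis
    by (simp add: tensor_op_def matrix_matrix_mult_def vec_eq_iff)
qed

lemma site_op_commute:
  assumes "k \<noteq> l"
  shows "site_op k A ** site_op l B = site_op l B ** site_op k A"
  unfolding site_op_def tensor_op_mult using assms
  by (intro arg_cong[where f = tensor_op]) auto

lemma pauli_dot_commute: "pauli_dot k l = pauli_dot l k"
  by (cases "k = l") (simp_all add: pauli_dot_def site_op_commute)

text \<open>The coupling as a function of the unordered pair of sites, the degenerate
  pair \<^term>\<open>Upair k k\<close> included.\<close>

lift_definition pair_coupling :: "'v::finite uprod \<Rightarrow> 'v qop" is "\<lambda>(k, l). pauli_dot k l"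
  by (auto simp: pauli_dot_commute)

lemma pair_coupling_Upair [simp]: "pair_coupling (Upair k l) = pauli_dot k l"
  by transfer simp

definition heisenberg :: "('v::finite \<Rightarrow> 'v \<Rightarrow> bool) \<Rightarrow> (nat \<Rightarrow> real) \<Rightarrow> real \<Rightarrow> 'v qop" where
  "heisenberg E J t = (1 / (2 * t)) *\<^sub>R
     (\<Sum>i = 0..graph_diameter E. J i *\<^sub>R
        (\<Sum>p\<in>{Upair k l | k l. gdist E k l = i}. pair_coupling p))"

text \<open>The exponential power series, written out because \<^const>\<open>exp\<close> and \<^const>\<open>power\<close> do not
  refer to the matrix product. \<^term>\<open>mat c\<close> is c times the identity matrix.\<close>

definition matrix_exp :: "complex ^ 'n ^ 'n \<Rightarrow> complex ^ 'n ^ 'n" where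
  "matrix_exp A = (\<Sum>n. (1 / fact n) *\<^sub>R (((**) A) ^^ n) (mat 1))"

definition evolve :: "'v::finite qop \<Rightarrow> real \<Rightarrow> 'v qstate \<Rightarrow> 'v qstate" where
  "evolve H t \<psi> = matrix_exp (mat (- \<i> * complex_of_real t) ** H) *v \<psi>"

definition one_particle :: "'v::finite \<Rightarrow> 'v qstate" where
  "one_particle k = axis (\<lambda>m. if m = k then 1 else 2) 1"

definition one_particle_state :: "('v::finite \<Rightarrow> complex) \<Rightarrow> 'v qstate" where
  "one_particle_state \<upsilon> = (\<Sum>k\<in>UNIV. \<upsilon> k *s one_particle k)"

text \<open>Entanglement of the qubits at distinct m and n in \<^term>\<open>one_particle_state \<upsilon>\<close>;
  the amplitudes \<open>\<upsilon>\<close> are determined by that state.\<close>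

definition concurrence :: "('v::finite \<Rightarrow> complex) \<Rightarrow> 'v \<Rightarrow> 'v \<Rightarrow> real" where
  "concurrence \<upsilon> m n = 2 * cmod (\<upsilon> m * \<upsilon> n)"

end

theory Submission
  imports Defs
begin

text \<open>Couple only antipodal pairs. As \<open>\<sigma>\<^sub>k \<cdot> \<sigma>\<^sub>l\<close> is twice the swap of the
  qubits k and l minus the identity, the Hamiltonian acts on the span of the two states
  \<open>|o\<rangle>\<close> and \<open>|o'\<rangle>\<close> as a multiple of the identity plus a multiple of their exchange. Coupling
  strength \<open>\<pi>/4\<close> at time 1 yields, up to a phase, \<open>cos (\<pi>/4) |o\<rangle> - i sin (\<pi>/4) |o'\<rangle>\<close>.\<close>

section \<open>Matrix exponential and time evolution\<close>

lemma summable_matrix_exp: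
  fixes A :: "complex ^ 'n ^ 'n"
  shows "summable (\<lambda>n. (1 / fact n) *\<^sub>R (((**) A) ^^ n) (mat 1))"
proof -
  \<comment> \<open>Left multiplication by \<open>A\<close> is linear on a finite-dimensional space,
    hence bounded. Its constant \<open>K\<close> does the work of a submultiplicative norm: the
    powers of \<open>A\<close> grow at most geometrically, and the factorials dominate.\<close>
  have "linear (\<lambda>B :: complex ^ 'n ^ 'n. A ** B)"
    by (rule linearI) (simp_all add: matrix_matrix_mult_def vec_eq_iff scaleR_sum_right
        sum.distrib distrib_left)
  then have "bounded_linear (\<lambda>B :: complex ^ 'n ^ 'n. A ** B)"
    by (simp add: linear_conv_bounded_linear)
  then obtain K where K: "K > 0" "\<And>B :: complex ^ 'n ^ 'n. norm (A ** B) \<le> norm B * K"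
    using bounded_linear.pos_bounded by blast
  have power_bound: "norm ((((**) A) ^^ n) (mat 1)) \<le> norm (mat 1 :: complex ^ 'n ^ 'n) * K ^ n" for n
  proof (induction n)
    case (Suc n)
    have "norm ((((**) A) ^^ Suc n) (mat 1)) \<le> norm ((((**) A) ^^ n) (mat 1)) * K"
      using K(2) by simp
    also have "\<dots> \<le> norm (mat 1 :: complex ^ 'n ^ 'n) * K ^ n * K"
      using Suc K(1) by (intro mult_right_mono) auto
    finally show ?case by (simp add: mult_ac)
  qed simp
  show ?thesis
  proof (rule summable_comparison_test')
    show "summable (\<lambda>n. norm (mat 1 :: complex ^ 'n ^ 'n) * (K ^ n /\<^sub>R fact n))"
      by (intro summable_mult summable_exp_generic)
    show "norm ((1 / fact n) *\<^sub>R (((**) A) ^^ n) (mat 1))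
        \<le> norm (mat 1 :: complex ^ 'n ^ 'n) * (K ^ n /\<^sub>R fact n)" for n
      using power_bound[of n] by (simp add: field_simps)
  qed
qed

text \<open>Applying a matrix to \<open>v\<close> is bounded linear in the matrix, so it passes
  through the convergent series; each power of \<open>A\<close> then acts on \<open>v\<close> as the
  same power of \<open>c\<close>.\<close>

lemma matrix_exp_eigenvector:
  fixes A :: "complex ^ 'n ^ 'n"
  assumes "A *v v = c *s v"
  shows "matrix_exp A *v v = exp c *s v"
proof -
  have bl1: "bounded_linear (\<lambda>B :: complex ^ 'n ^ 'n. B *v v)"
    unfolding linear_conv_bounded_linear[symmetric]
    by (rule linearI) (simp_all add: matrix_vector_mult_def vec_eq_iff scaleR_sum_right
        sum.distrib distrib_right)
  have bl2: "bounded_linear (\<lambda>z :: complex. z *s v)"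
    unfolding linear_conv_bounded_linear[symmetric]
    by (rule linearI) (simp_all add: vec_eq_iff algebra_simps)
  have power: "(((**) A) ^^ n) (mat 1) *v v = (c ^ n) *s v" for n
  proof (induction n)
    case (Suc n)
    then show ?case
      using assms
      by (simp add: matrix_vector_mul_assoc[symmetric] vec.scale mult_ac)
  qed simp
  have "matrix_exp A *v v = (\<Sum>n. ((1 / fact n) *\<^sub>R (((**) A) ^^ n) (mat 1)) *v v)"
    unfolding matrix_exp_def by (rule bounded_linear.suminf[OF bl1 summable_matrix_exp])
  also have "\<dots> = (\<Sum>n. (c ^ n /\<^sub>R fact n) *s v)"
  proof (rule suminf_cong)
    fix n
    have "((1 / fact n) *\<^sub>R (((**) A) ^^ n) (mat 1)) *v v
        = (1 / fact n) *\<^sub>R ((((**) A) ^^ n) (mat 1) *v v)"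
      by (rule linear_cmul[OF bounded_linear.linear[OF bl1]])
    then show "((1 / fact n) *\<^sub>R (((**) A) ^^ n) (mat 1)) *v v = (c ^ n /\<^sub>R fact n) *s v"
      unfolding power by (simp add: vec_eq_iff field_simps)
  qed
  also have "\<dots> = exp c *s v"
    unfolding exp_def
    by (rule bounded_linear.suminf[OF bl2 summable_exp_generic, symmetric])
  finally show ?thesis .
qed

lemma evolve_eigenvector:
  assumes "H *v v = complex_of_real h *s v"
  shows "evolve H t v = cis (- h * t) *s v"
proof -
  have mat: "mat c *v w = c *s w" for c :: complex and w :: "'v::finite qstate"
    by (simp add: vec_eq_iff matrix_vector_mult_def mat_def
        if_distrib[of "\<lambda>z. z * _"] cong: if_cong)
  have "(mat (- \<i> * complex_of_real t) ** H) *v v = (\<i> * complex_of_real (- h * t)) *s v"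
    unfolding matrix_vector_mul_assoc[symmetric] assms mat by (simp add: mult_ac)
  from matrix_exp_eigenvector[OF this] show ?thesis
    by (simp add: evolve_def cis_conv_exp)
qed

text \<open>The sum and the difference of \<open>u\<close> and \<open>w\<close> satisfy the
  eigenvector equation with values \<open>a + b\<close> and \<open>a - b\<close>. Evolving the two
  halves of \<open>u\<close> separately leaves the common phase of \<open>a\<close>, while the
  opposite phases of \<open>b\<close> combine into cosine and sine.\<close>

lemma evolve_exchange:
  assumes "H *v u = complex_of_real a *s u + complex_of_real b *s w"
    and "H *v w = complex_of_real a *s w + complex_of_real b *s u"
  shows "evolve H t u = (cis (- a * t) * cos (b * t)) *s u - (cis (- a * t) * \<i> * sin (b * t)) *s w"
proof -
  have plus: "H *v (u + w) = complex_of_real (a + b) *s (u + w)"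
    unfolding vec.add assms by (simp add: vec_eq_iff algebra_simps)
  have minus: "H *v (u - w) = complex_of_real (a - b) *s (u - w)"
    unfolding vec.diff assms by (simp add: vec_eq_iff algebra_simps)
  have "u = (1/2) *s (u + w) + (1/2) *s (u - w)"
    by (simp add: vec_eq_iff field_simps)
  then have "evolve H t u = (1/2) *s evolve H t (u + w) + (1/2) *s evolve H t (u - w)"
    unfolding evolve_def by (metis vec.add vec.scale)
  also have "\<dots> = (1/2) *s (cis (- (a + b) * t) *s (u + w)) + (1/2) *s (cis (- (a - b) * t) *s (u - w))"
    unfolding evolve_eigenvector[OF plus] evolve_eigenvector[OF minus] ..
  also have "cis (- (a + b) * t) = cis (- a * t) * cis (- (b * t))"
    by (simp add: cis_mult algebra_simps)
  also have "cis (- (a - b) * t) = cis (- a * t) * cis (b * t)"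
    by (simp add: cis_mult algebra_simps)
  also have "cis (- (b * t)) = complex_of_real (cos (b * t)) - \<i> * complex_of_real (sin (b * t))"
    by (simp add: complex_eq_iff)
  also have "cis (b * t) = complex_of_real (cos (b * t)) + \<i> * complex_of_real (sin (b * t))"
    by (simp add: complex_eq_iff)
  finally show ?thesis
    by (simp add: vec_eq_iff field_simps)
qed

section \<open>The two-qubit coupling as a swap\<close>

lemma site_op_mult_entry:
  assumes "k \<noteq> l"
  shows "(site_op k A ** site_op l B) $ r $ s =
    (if \<forall>m. m \<noteq> k \<and> m \<noteq> l \<longrightarrow> r m = s m then A $ r k $ s k * B $ r l $ s l else 0)"
proof -
  let ?f = "\<lambda>m. ((if m = k then A else mat 1) ** (if m = l then B else mat 1)) $ r m $ s m"
  have "(site_op k A ** site_op l B) $ r $ s = prod ?f UNIV"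
    unfolding site_op_def tensor_op_mult by (simp add: tensor_op_def)
  also have "\<dots> = ?f k * (?f l * prod ?f (UNIV - {k} - {l}))"
    using assms prod.remove[of UNIV k ?f] prod.remove[of "UNIV - {k}" l ?f] by simp
  \<comment> \<open>Away from \<open>k\<close> and \<open>l\<close> every tensor factor is the
    identity, so this product tests whether \<open>r\<close> and \<open>s\<close> agree
    there.\<close>
  also have "prod ?f (UNIV - {k} - {l}) =
      (\<Prod>m\<in>UNIV - {k} - {l}. if r m = s m then 1 else 0)"
  proof (rule prod.cong)
    fix m
    assume "m \<in> UNIV - {k} - {l}"
    then have "?f m = mat 1 $ r m $ s m" by simp
    then show "?f m = (if r m = s m then 1 else 0)" by (simp add: mat_def)
  qed simp
  also have "\<dots> = (if \<forall>m. m \<noteq> k \<and> m \<noteq> l \<longrightarrow> r m = s m then 1 else 0)"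
    by (auto intro!: prod.neutral)
  also have "?f k * (?f l * (if \<forall>m. m \<noteq> k \<and> m \<noteq> l \<longrightarrow> r m = s m then 1 else 0)) =
      (if \<forall>m. m \<noteq> k \<and> m \<noteq> l \<longrightarrow> r m = s m then ?f k * ?f l else 0)"
    by (simp only: mult_1_right mult_zero_right if_distrib[of "\<lambda>z. _ * z"])
  also have "?f k = A $ r k $ s k"
    using assms by simp
  also have "?f l = B $ r l $ s l"
    using assms by simp
  finally show ?thesis .
qed

lemma pauli_dot_entry:
  assumes "k \<noteq> l"
  shows "pauli_dot k l $ r $ s =
    (if r = s \<circ> Transposition.transpose k l then 2 else 0) - (if r = s then 1 else 0)"
proof -
  have swap: "r = s \<circ> Transposition.transpose k l \<longleftrightarrow>
      r k = s l \<and> r l = s k \<and> (\<forall>m. m \<noteq> k \<and> m \<noteq> l \<longrightarrow> r m = s m)"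
    using assms by (auto simp: fun_eq_iff Transposition.transpose_def)
  have eq: "r = s \<longleftrightarrow> r k = s k \<and> r l = s l \<and> (\<forall>m. m \<noteq> k \<and> m \<noteq> l \<longrightarrow> r m = s m)"
    by (auto simp: fun_eq_iff)
  \<comment> \<open>The identity for just two qubits, checked on all sixteen index
    combinations.\<close>
  have two_sites: "pauli_x $ a $ c * pauli_x $ b $ d + pauli_y $ a $ c * pauli_y $ b $ d
      + pauli_z $ a $ c * pauli_z $ b $ d =
      (if a = d \<and> b = c then 2 else 0) - (if a = c \<and> b = d then 1 else 0)" for a b c d :: 2
    using exhaust_2[of a] exhaust_2[of b] exhaust_2[of c] exhaust_2[of d]
    by (elim disjE) (simp_all add: pauli_x_def pauli_y_def pauli_z_def)
  \<comment> \<open>Extends the two-qubit identity to all sites; \<open>P\<close> is the condition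
    that the remaining sites agree, and both sides vanish without it.\<close>
  have factor: "(if P then a else 0) + (if P then b else 0) + (if P then c else 0) =
      (if Q \<and> Q' \<and> P then 2 else 0) - (if R \<and> R' \<and> P then 1 else 0)"
    if "a + b + c = (if Q \<and> Q' then 2 else 0) - (if R \<and> R' then 1 else 0)"
    for P Q Q' R R' and a b c :: complex
    using that by simp
  show ?thesis
    unfolding pauli_dot_def vector_add_component site_op_mult_entry[OF assms] swap eq
    by (rule factor[OF two_sites])
qed

lemma pauli_dot_one_particle:
  assumes "k \<noteq> l"
  shows "pauli_dot k l *v one_particle x =
    2 *s one_particle (Transposition.transpose k l x) - one_particle x"
proof -
  \<comment> \<open>A transposition is its own inverse, so precomposing with it moves the single up
    spin from \<open>x\<close> to the image of \<open>x\<close>.\<close>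
  have "(\<lambda>m. if m = x then 1 else 2 :: 2) \<circ> Transposition.transpose k l =
      (\<lambda>m. if m = Transposition.transpose k l x then 1 else 2)"
    by (auto simp: fun_eq_iff Transposition.transpose_def)
  then show ?thesis
    by (simp add: one_particle_def vec_eq_iff matrix_vector_mult_def axis_def
        pauli_dot_entry[OF assms] if_distrib[of "\<lambda>z. _ * z"] cong: if_cong)
qed

section \<open>Distances and antipodes\<close>

lemma gdist_commute:
  assumes "symp E"
  shows "gdist E x y = gdist E y x"
proof -
  \<comment> \<open>Walks can be reversed, so both distances minimise over the same set of
    lengths.\<close>
  have "(E ^^ n) y x" if "(E ^^ n) x y" for n x y
    using that
  proof (induction n arbitrary: y)
    case (Suc n)
    then obtain z where "(E ^^ n) x z" "E z y" by auto
    then show ?case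
      using Suc.IH assms by (blast intro: relpowp_Suc_I2 dest: sympD)
  qed simp
  then have "(E ^^ n) x y \<longleftrightarrow> (E ^^ n) y x" for n
    by blast
  then show ?thesis by (simp add: gdist_def)
qed

lemma gdist_self [simp]: "gdist E x x = 0"
  by (simp add: gdist_def)

lemma gdist_eq_diameter_iff:
  assumes "antipodal E"
  shows "gdist E x y = graph_diameter E \<longleftrightarrow> y = antipode E x"
proof -
  have "\<exists>!y. gdist E x y = graph_diameter E"
    using assms by (simp add: antipodal_def)
  from theI'[OF this] this show ?thesis
    unfolding antipode_def by blast
qed

section \<open>The Hamiltonian that couples antipodal pairs\<close>

lemma heisenberg_single_distance:
  assumes "i \<le> graph_diameter E"
  shows "heisenberg E (\<lambda>j. if j = i then c else 0) t =
    (c / (2 * t)) *\<^sub>R (\<Sum>p\<in>{Upair k l | k l. gdist E k l = i}. pair_coupling p)"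
proof -
  have "(\<Sum>j = 0..graph_diameter E. (if j = i then c else 0) *\<^sub>R
        (\<Sum>p\<in>{Upair k l | k l. gdist E k l = j}. pair_coupling p)) =
      (\<Sum>j = 0..graph_diameter E. if i = j then c *\<^sub>R
        (\<Sum>p\<in>{Upair k l | k l. gdist E k l = j}. pair_coupling p) else 0)"
    by (rule sum.cong) auto
  then show ?thesis
    using assms by (simp add: heisenberg_def)
qed

lemma sum_matrix_vector_mult:
  fixes A :: "'a \<Rightarrow> complex ^ 'n ^ 'm"
  shows "(\<Sum>p\<in>S. A p) *v v = (\<Sum>p\<in>S. A p *v v)"
  by (induction S rule: infinite_finite_induct) (simp_all add: matrix_vector_mult_add_rdistrib)

text \<open>Antipodal pairs partition the vertices, so exactly one coupled pair contains
  \<open>y\<close>. It contributes twice the exchanged state minus the original one; each of the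
  other \<open>card S - 1\<close> pairs fixes the state. The diagonal coefficient is therefore
  \<open>card S - 2\<close>.\<close>

lemma antipodal_coupling_one_particle:
  fixes E :: "'v::finite \<Rightarrow> 'v \<Rightarrow> bool"
  assumes "symp E" "antipodal E" "graph_diameter E \<ge> 1"
  defines "S \<equiv> {Upair k l | k l. gdist E k l = graph_diameter E}"
  shows "(\<Sum>p\<in>S. pair_coupling p) *v one_particle y =
    complex_of_real (real (card S) - 2) *s one_particle y + 2 *s one_particle (antipode E y)"
proof -
  let ?p = "Upair y (antipode E y)"
  have [simp]: "finite S"
    by (rule finite_subset[of _ "case_prod Upair ` UNIV"]) (auto simp: S_def)
  have distinct: "k \<noteq> l" if "gdist E k l = graph_diameter E" for k l
    using that assms(3) by auto
  have other: "antipode E l = k" if "l = antipode E k" for k l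
    using that gdist_eq_diameter_iff[OF assms(2)] gdist_commute[OF assms(1)] by metis
  have p: "gdist E y (antipode E y) = graph_diameter E"
    by (simp add: gdist_eq_diameter_iff[OF assms(2)])
  then have "?p \<in> S"
    by (auto simp: S_def)
  \<comment> \<open>Keeps the natural-number subtraction \<open>card S - 1\<close> from truncating
    when it is cast below.\<close>
  then have "card S \<ge> 1"
    by (auto simp: Suc_le_eq card_gt_0_iff)
  have rest: "pair_coupling q *v one_particle y = one_particle y" if "q \<in> S - {?p}" for q
  proof -
    from that obtain k l where q: "q = Upair k l" "gdist E k l = graph_diameter E"
      by (auto simp: S_def)
    then have l: "l = antipode E k"
      by (simp add: gdist_eq_diameter_iff[OF assms(2)])
    \<comment> \<open>If \<open>y\<close> were either end, the unordered pair \<open>q\<close> would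
      be \<open>?p\<close>; for \<open>y = l\<close> this uses that the antipode of \<open>l\<close>
      is \<open>k\<close>.\<close>
    with that q other[OF l] have "y \<noteq> k" "y \<noteq> l"
      by auto
    then have "Transposition.transpose k l y = y"
      by (simp add: Transposition.transpose_def)
    then show ?thesis
      using pauli_dot_one_particle[OF distinct[OF q(2)], of y]
      by (simp add: q(1) vec_eq_iff)
  qed
  have "(\<Sum>q\<in>S. pair_coupling q) *v one_particle y = (\<Sum>q\<in>S. pair_coupling q *v one_particle y)"
    by (rule sum_matrix_vector_mult)
  also have "\<dots> = pair_coupling ?p *v one_particle y + (\<Sum>q\<in>S - {?p}. pair_coupling q *v one_particle y)"
    using \<open>?p \<in> S\<close> by (simp add: sum.remove)
  also have "(\<Sum>q\<in>S - {?p}. pair_coupling q *v one_particle y) = (\<Sum>q\<in>S - {?p}. one_particle y)"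
    by (rule sum.cong) (simp_all add: rest)
  also have "\<dots> = complex_of_real (real (card S) - 1) *s one_particle y"
    unfolding sum_constant_scaleR using \<open>?p \<in> S\<close> \<open>card S \<ge> 1\<close>
    by (simp add: vec_eq_iff of_nat_diff scaleR_conv_of_real[where 'a = complex] left_diff_distrib)
  finally show ?thesis
    unfolding pair_coupling_Upair pauli_dot_one_particle[OF distinct[OF p]]
    by (simp add: vec_eq_iff left_diff_distrib)
qed

theorem mainTheorem5:
  fixes E :: "'v::finite \<Rightarrow> 'v \<Rightarrow> bool" and x :: 'v
  assumes "association_scheme_graph E"
    and "antipodal E"
    and "graph_diameter E \<ge> 1"
  shows "\<exists>(J :: nat \<Rightarrow> real) t. t > 0 \<and>
    (\<exists>\<upsilon>. evolve (heisenberg E J t) t (one_particle x) = one_particle_state \<upsilon> \<and>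
         concurrence \<upsilon> x (antipode E x) = 1)"
proof -
  let ?x' = "antipode E x"
  \<comment> \<open>At time 1 the prefactor 1/2 cancels the factor 2 of the swap, so the exchange
    strength is \<open>pi / 4\<close>, the angle at which cosine and sine are equal.\<close>
  let ?J = "\<lambda>i. if i = graph_diameter E then pi / 4 else 0"
  \<comment> \<open>The diagonal part of the Hamiltonian, which enters only as a global
    phase.\<close>
  define a where "a = pi / 8 * (real (card {Upair k l | k l. gdist E k l = graph_diameter E}) - 2)"
  define \<upsilon> where "\<upsilon> = (\<lambda>k. if k = x then cis (- a) * cos (pi / 4)
    else if k = ?x' then - (cis (- a) * \<i> * sin (pi / 4)) else 0)"
  have sym: "symp E"
    using assms(1) by (simp add: association_scheme_graph_def connected_simple_graph_def)
  have dist: "gdist E x ?x' = graph_diameter E"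
    by (simp add: gdist_eq_diameter_iff[OF assms(2)])
  have "?x' \<noteq> x"
    using dist assms(3) by (metis gdist_self not_one_le_zero)
  \<comment> \<open>This closes the span of the two one-particle states under the Hamiltonian, as
    \<open>evolve_exchange\<close> requires.\<close>
  have "antipode E ?x' = x"
    using dist gdist_commute[OF sym] gdist_eq_diameter_iff[OF assms(2)] by metis
  have scale: "(r *\<^sub>R M) *v v = complex_of_real r *s (M *v v)" for r :: real and M :: "'v qop" and v
    by (simp add: vec_eq_iff matrix_vector_mult_def sum_distrib_left
        scaleR_conv_of_real[where 'a = complex] mult_ac)
  have H: "heisenberg E ?J 1 *v one_particle y =
      complex_of_real a *s one_particle y + complex_of_real (pi / 4) *s one_particle (antipode E y)" for y
    unfolding heisenberg_single_distance[OF order_refl] scale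
      antipodal_coupling_one_particle[OF sym assms(2,3)]
    by (simp add: a_def vec_eq_iff algebra_simps)
  have "evolve (heisenberg E ?J 1) 1 (one_particle x) =
      (cis (- a) * cos (pi / 4)) *s one_particle x - (cis (- a) * \<i> * sin (pi / 4)) *s one_particle ?x'"
    using evolve_exchange[OF H H[of ?x', unfolded \<open>antipode E ?x' = x\<close>], of 1] by simp
  also have "\<dots> = one_particle_state \<upsilon>"
  proof -
    have "one_particle_state \<upsilon> = (\<Sum>k\<in>{x, ?x'}. \<upsilon> k *s one_particle k)"
      unfolding one_particle_state_def
      by (rule sum.mono_neutral_right) (auto simp: \<upsilon>_def)
    then show ?thesis
      using \<open>?x' \<noteq> x\<close> by (simp add: \<upsilon>_def vec_eq_iff)
  qed
  finally have "evolve (heisenberg E ?J 1) 1 (one_particle x) = one_particle_state \<upsilon>" .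
  \<comment> \<open>Both amplitudes have modulus 1/sqrt 2, so twice the modulus of their product is
    1.\<close>
  moreover have "concurrence \<upsilon> x ?x' = 1"
    using \<open>?x' \<noteq> x\<close> by (simp add: concurrence_def \<upsilon>_def norm_mult cos_45 sin_45)
  ultimately show ?thesis
    by (intro exI[of _ ?J] exI[of _ "1 :: real"]) auto
qed

end
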